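(* Let $\mathbf{w}=(w_p,w_b,w_c,w_h)$ be a weight vector, and let $s$ be a skill with signal vector $\mathbf{T}=(T_p,T_b,T_c,T_h)\in[0,1]^4$ and trust score $T(s)=\mathbf{w}\cdot\mathbf{T}$. Let $e$ be positive evidence, i.e. evidence changing the signal vector to some $\mathbf{T}'=(T_p',T_b',T_c',T_h')\in[0,1]^4$ with $T_p'\ge T_p$, $T_b'\ge T_b$, $T_c'\ge T_c$, $T_h'\ge T_h$ and at least one strict inequality. Then $$T(s\mid e)=\mathbf{w}\cdot\mathbf{T}'\ \ge\ \mathbf{w}\cdot\mathbf{T}=T(s).$$ Moreover, $T(s\mid e)>T(s)$ whenever a strict inequality occurs on a signal $i\in\{p,b,c,h\}$ with $w_i>0$.
   Context: A weight vector is $\mathbf{w}=(w_p,w_b,w_c,w_h)\in\mathbb{R}^4$ with all entries $\ge 0$ and $w_p+w_b+w_c+w_h=1$. The trust signals (provenance $p$, behavioral $b$, community $c$, historical $h$) take values in $[0,1]$. The intrinsic trust score is $T(s)=w_pT_p+w_bT_b+w_cT_c+w_hT_h$, and $T(s\mid e)$ is the score computed with the updated signal vector $\mathbf{T}'$ and the same weights. *)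

theory Defs
  imports "HOL-Analysis.Analysis"
begin

datatype signal = Provenance | Behavioral | Community | Historical

lemma UNIV_signal: "(UNIV :: signal set) = {Provenance, Behavioral, Community, Historical}"
  by (auto intro: signal.exhaust)

instance signal :: finite
  by standard (simp add: UNIV_signal)

text \<open>Vectors in four-dimensional space, with coordinates named by the four trust signals.\<close>

type_synonym signal_vec = "real ^ signal"

definition weight_vector :: "signal_vec \<Rightarrow> bool" where
  "weight_vector w \<longleftrightarrow>
     (\<forall>i. w $ i \<ge> 0) \<and>
     w $ Provenance + w $ Behavioral + w $ Community + w $ Historical = 1"

definition signal_vector :: "signal_vec \<Rightarrow> bool" where
  "signal_vector T \<longleftrightarrow> (\<forall>i. T $ i \<in> {0..1})"

definition score :: "signal_vec \<Rightarrow> signal_vec \<Rightarrow> real" where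
  "score w T =
     w $ Provenance * T $ Provenance + w $ Behavioral * T $ Behavioral +
     w $ Community * T $ Community + w $ Historical * T $ Historical"

text \<open>
  Skills and pieces of evidence are elements of arbitrary types. They enter only through
  the signal vector \<open>sig s\<close> of a skill \<open>s\<close> and the signal vector \<open>upd s e\<close> that \<open>s\<close> has
  after evidence \<open>e\<close>.
\<close>

definition trust :: "signal_vec \<Rightarrow> ('s \<Rightarrow> signal_vec) \<Rightarrow> 's \<Rightarrow> real" where
  "trust w sig s = score w (sig s)"

definition trust_given ::
    "signal_vec \<Rightarrow> ('s \<Rightarrow> 'e \<Rightarrow> signal_vec) \<Rightarrow> 's \<Rightarrow> 'e \<Rightarrow> real" where
  "trust_given w upd s e = score w (upd s e)"

definition positive_evidence ::
    "('s \<Rightarrow> signal_vec) \<Rightarrow> ('s \<Rightarrow> 'e \<Rightarrow> signal_vec) \<Rightarrow> 's \<Rightarrow> 'e \<Rightarrow> bool" where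
  "positive_evidence sig upd s e \<longleftrightarrow>
     signal_vector (upd s e) \<and>
     (\<forall>i. upd s e $ i \<ge> sig s $ i) \<and>
     (\<exists>i. upd s e $ i > sig s $ i)"

end

theory Submission
  imports Defs
begin

text \<open>The score is the inner product with \<open>w\<close>, so evidence changes it by the sum
  of the terms w_i (T'_i - T_i). Positive evidence and nonnegative weights make every term
  nonnegative, and a term with w_i > 0 and T'_i > T_i is positive. \<open>inner_vec_mono\<close> and
  \<open>inner_vec_strict_mono\<close> state this for any finite index type.\<close>

lemma score_eq_inner: "score w T = w \<bullet> T"
  by (simp add: score_def inner_vec_def UNIV_signal add_ac)

lemma inner_vec_mono:
  fixes w x y :: "real ^ 'n"
  assumes "\<And>i. 0 \<le> w $ i" and "\<And>i. x $ i \<le> y $ i"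
  shows "w \<bullet> x \<le> w \<bullet> y"
  unfolding inner_vec_def using assms by (auto intro!: sum_mono mult_left_mono)

text \<open>One coordinate \<open>k\<close> is enough: its positive weight keeps the gain from being
  multiplied by zero, and no other coordinate can offset it.\<close>

lemma inner_vec_strict_mono:
  fixes w x y :: "real ^ 'n"
  assumes "\<And>i. 0 \<le> w $ i" and "\<And>i. x $ i \<le> y $ i"
    and "0 < w $ k" and "x $ k < y $ k"
  shows "w \<bullet> x < w \<bullet> y"
  unfolding inner_vec_def
proof (rule sum_strict_mono_ex1)
  show "\<forall>i\<in>UNIV. w $ i \<bullet> x $ i \<le> w $ i \<bullet> y $ i"
    using assms by (auto intro: mult_left_mono)
  show "\<exists>i\<in>UNIV. w $ i \<bullet> x $ i < w $ i \<bullet> y $ i"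
    using assms by (auto intro!: exI[of _ k])
qed simp

theorem theorem7p12:
  fixes w :: signal_vec
    and sig :: "'s \<Rightarrow> signal_vec"
    and upd :: "'s \<Rightarrow> 'e \<Rightarrow> signal_vec"
    and s :: 's and e :: 'e
  assumes "weight_vector w"
    and "signal_vector (sig s)"
    and "positive_evidence sig upd s e"
  shows "trust_given w upd s e = w \<bullet> upd s e \<and>
         w \<bullet> upd s e \<ge> w \<bullet> sig s \<and>
         w \<bullet> sig s = trust w sig s \<and>
         ((\<exists>i. w $ i > 0 \<and> upd s e $ i > sig s $ i) \<longrightarrow> trust_given w upd s e > trust w sig s)"
proof -
  have w: "0 \<le> w $ i" for i
    using assms(1) by (simp add: weight_vector_def)
  have le: "sig s $ i \<le> upd s e $ i" for i
    using assms(3) by (simp add: positive_evidence_def)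
  show ?thesis
    \<comment> \<open>The coordinate \<open>k\<close> stays schematic here, to be matched with the
      one that the existential premise supplies.\<close>
    using inner_vec_mono[OF w le] inner_vec_strict_mono[OF w le]
    by (auto simp: trust_def trust_given_def score_eq_inner)
qed

end
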